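(* Let $n\ge 0$ and $\alpha\ge 1$ be integers, and let $p$ be an odd prime with $\left(\frac{-3}{p}\right)=-1$. Then for every $j\in\{1,2,\ldots,p-1\}$, $$p_{3,3}\left(9p^{2\alpha}n+\frac{p^{2\alpha-1}(3p+18j)+1}{2}\right)\equiv 0 \pmod{27}.$$
   Context: For $|q|<1$ let $(a;q)_\infty:=\prod_{k\ge 0}(1-aq^k)$. The function $p_{3,3}(n)$ (the number of $2$-color partition triples of $n$ where one of the colors appears only in parts that are multiples of $3$) is defined for integers $n\ge 0$ by the generating function $$\sum_{n\ge 0}p_{3,3}(n)q^n:=\frac{1}{(q;q)_\infty^3(q^3;q^3)_\infty^3}.$$ Here $\left(\frac{\cdot}{p}\right)$ denotes the Legendre symbol. *)

theory Defs
  imports "HOL-Complex_Analysis.Complex_Analysis" "HOL-Number_Theory.Number_Theory"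
begin

definition qpochhammer_inf :: "complex \<Rightarrow> complex \<Rightarrow> complex" where
  "qpochhammer_inf a q = (\<Prod>k. 1 - a * q ^ k)"

text \<open>
  The definite description \<^const>\<open>The\<close> below is well-defined: the generating function has a unique
  sequence of power series coefficients on the unit disc, and they are natural numbers. This is
  \<open>p33_generating_p33\<close> at the end of this theory.
\<close>

definition p33_generating :: "(nat \<Rightarrow> nat) \<Rightarrow> bool" where
  "p33_generating c \<longleftrightarrow>
     (\<forall>q::complex. norm q < 1 \<longrightarrow>
        (\<lambda>n. of_nat (c n) * q ^ n) sums
          (1 / (qpochhammer_inf q q ^ 3 * qpochhammer_inf (q ^ 3) (q ^ 3) ^ 3)))"

definition p33 :: "nat \<Rightarrow> nat" where
  "p33 = (THE c. p33_generating c)"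


subsection \<open>Well-definedness\<close>

lemma convergent_prod_qpochhammer:
  assumes "norm (q::complex) < 1"
  shows "convergent_prod (\<lambda>k. 1 - q * q ^ k)"
proof (intro abs_convergent_prod_imp_convergent_prod summable_imp_abs_convergent_prod)
  have "summable (\<lambda>k. norm q * norm q ^ k)"
    by (intro summable_mult summable_geometric) (use assms in auto)
  thus "summable (\<lambda>k. norm (1 - q * q ^ k - 1))"
    by (simp add: norm_mult norm_power)
qed

lemma qpochhammer_factor_nonzero:
  assumes "norm (q::complex) < 1"
  shows "1 - q * q ^ k \<noteq> 0"
proof
  assume "1 - q * q ^ k = 0"
  hence "norm (q ^ Suc k) = 1" by simp
  moreover have "norm (q ^ Suc k) < 1"
    unfolding norm_power using assms by (subst power_less_one_iff) auto
  ultimately show False by simp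
qed

lemma qpochhammer_inf_nonzero:
  assumes "norm (q::complex) < 1"
  shows "qpochhammer_inf q q \<noteq> 0"
  unfolding qpochhammer_inf_def
  by (intro prodinf_nonzero convergent_prod_qpochhammer qpochhammer_factor_nonzero assms)

lemma uniform_limit_qpochhammer:
  assumes "0 \<le> r" "r < 1"
  shows "uniform_limit (cball 0 r) (\<lambda>N q. \<Prod>k<N. 1 - q * q ^ k)
           (\<lambda>q. qpochhammer_inf q q) sequentially"
proof -
  have "uniformly_convergent_on (cball 0 r) (\<lambda>N q::complex. \<Prod>k<N. 1 - q * q ^ k)"
  proof (rule uniformly_convergent_on_prod')
    show "uniformly_convergent_on (cball 0 r) (\<lambda>N q::complex. \<Sum>n<N. norm (1 - q * q ^ n - 1))"
    proof (rule Weierstrass_m_test')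
      fix n and q :: complex
      assume "q \<in> cball 0 r"
      hence "norm q ^ Suc n \<le> r ^ Suc n" by (intro power_mono) auto
      thus "norm (norm (1 - q * q ^ n - 1)) \<le> r * r ^ n"
        by (simp add: norm_mult norm_power)
    next
      show "summable (\<lambda>n. r * r ^ n)"
        using assms by (intro summable_mult summable_geometric) auto
    qed
  qed (auto intro!: continuous_intros)
  then obtain l where l: "uniform_limit (cball 0 r)
      (\<lambda>N q::complex. \<Prod>k<N. 1 - q * q ^ k) l sequentially"
    by (auto simp: uniformly_convergent_on_def)
  have "l q = qpochhammer_inf q q" if q: "q \<in> cball 0 r" for q
  proof (rule LIMSEQ_unique)
    show "(\<lambda>N. \<Prod>k<N. 1 - q * q ^ k) \<longlonglongrightarrow> l q"
      by (rule tendsto_uniform_limitI[OF l q])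
    have "norm q < 1" using q assms by auto
    from convergent_prod_LIMSEQ[OF convergent_prod_qpochhammer[OF this]]
    show "(\<lambda>N. \<Prod>k<N. 1 - q * q ^ k) \<longlonglongrightarrow> qpochhammer_inf q q"
      unfolding qpochhammer_inf_def by (simp add: LIMSEQ_lessThan_iff_atMost)
  qed
  with l show ?thesis
    by (subst uniform_limit_cong'[of _ _ _ _ l]) auto
qed

lemma holomorphic_qpochhammer: "(\<lambda>q. qpochhammer_inf q q) holomorphic_on ball 0 1"
proof (rule holomorphic_uniform_sequence)
  fix q :: complex assume q: "q \<in> ball 0 1"
  define d where "d = (1 - norm q) / 2"
  have sub: "cball q d \<subseteq> cball 0 (norm q + d)"
    by (intro cball_subset_cball_iff[THEN iffD2]) (auto simp: dist_norm)
  have "uniform_limit (cball 0 (norm q + d)) (\<lambda>N q. \<Prod>k<N. 1 - q * q ^ k)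
           (\<lambda>q. qpochhammer_inf q q) sequentially"
    by (rule uniform_limit_qpochhammer) (use q in \<open>auto simp: d_def field_simps\<close>)
  hence "uniform_limit (cball q d) (\<lambda>N q. \<Prod>k<N. 1 - q * q ^ k)
           (\<lambda>q. qpochhammer_inf q q) sequentially"
    by (rule uniform_limit_on_subset[OF _ sub])
  moreover have "cball q d \<subseteq> ball 0 1"
    using sub by (rule order.trans) (use q in \<open>auto simp: d_def field_simps\<close>)
  moreover have "d > 0" using q by (auto simp: d_def)
  ultimately show "\<exists>d>0. cball q d \<subseteq> ball 0 1 \<and>
      uniform_limit (cball q d) (\<lambda>N q. \<Prod>k<N. 1 - q * q ^ k) (\<lambda>q. qpochhammer_inf q q) sequentially"
    by blast
qed (auto intro!: holomorphic_intros)

definition nat_expansion :: "(complex \<Rightarrow> complex) \<Rightarrow> bool" where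
  "nat_expansion f \<longleftrightarrow> (\<exists>F. f has_fps_expansion F \<and> (\<forall>n. fps_nth F n \<in> \<nat>))"

lemma nat_expansion_1: "nat_expansion (\<lambda>_. 1)"
  unfolding nat_expansion_def by (intro exI[of _ 1]) auto

lemma sum_in_Nats: "(\<And>x. x \<in> A \<Longrightarrow> f x \<in> \<nat>) \<Longrightarrow> sum f A \<in> \<nat>"
  by (induction A rule: infinite_finite_induct) auto

lemma nat_expansion_mult:
  assumes "nat_expansion f" "nat_expansion g"
  shows "nat_expansion (\<lambda>z. f z * g z)"
proof -
  from assms obtain F G where
    "f has_fps_expansion F" "g has_fps_expansion G"
    "\<And>n. fps_nth F n \<in> \<nat>" "\<And>n. fps_nth G n \<in> \<nat>"
    unfolding nat_expansion_def by blast
  thus ?thesis unfolding nat_expansion_def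
    by (intro exI[of _ "F * G"])
       (auto intro!: has_fps_expansion_mult sum_in_Nats Nats_mult simp: fps_mult_nth)
qed

lemma nat_expansion_power: "nat_expansion f \<Longrightarrow> nat_expansion (\<lambda>z. f z ^ n)"
  by (induction n) (auto intro: nat_expansion_1 nat_expansion_mult)

lemma nat_expansion_prod:
  "(\<And>k. k < (N::nat) \<Longrightarrow> nat_expansion (f k)) \<Longrightarrow> nat_expansion (\<lambda>z. \<Prod>k<N. f k z)"
  by (induction N) (auto intro: nat_expansion_1 nat_expansion_mult)

lemma nat_expansion_geometric:
  assumes "m > 0"
  shows "nat_expansion (\<lambda>z. inverse (1 - z ^ m))"
proof -
  define F :: "complex fps" where "F = inverse (1 - fps_X ^ m)"
  have 0: "fps_nth (1 - fps_X ^ m :: complex fps) 0 \<noteq> 0"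
    using assms by auto
  have "F * (1 - fps_X ^ m) = 1"
    unfolding F_def using 0 by (rule inverse_mult_eq_1)
  hence F: "F = 1 + fps_X ^ m * F"
    by (simp add: algebra_simps)
  have "fps_nth F n \<in> \<nat>" for n
  proof (induction n rule: less_induct)
    case (less n)
    have "fps_nth F n = fps_nth (1 + fps_X ^ m * F) n"
      using F by simp
    also have "\<dots> = (if n = 0 then 1 else 0) + (if n < m then 0 else fps_nth F (n - m))"
      by (simp add: fps_X_power_mult_nth)
    also have "\<dots> \<in> \<nat>"
      using less[of "n - m"] assms by (auto intro!: Nats_add)
    finally show ?case .
  qed
  moreover have "(\<lambda>z. inverse (1 - z ^ m)) has_fps_expansion F"
    unfolding F_def using 0 by (intro fps_expansion_intros)
  ultimately show ?thesis
    unfolding nat_expansion_def by blast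
qed

lemma nat_expansion_limit:
  assumes "uniform_limit (ball 0 r) f g sequentially" "r > 0"
    and "\<And>N. f N holomorphic_on ball 0 r" "\<And>N. nat_expansion (f N)"
    and "g holomorphic_on ball 0 r"
  shows "nat_expansion g"
proof -
  have "(deriv ^^ n) g 0 / fact n \<in> \<nat>" for n
  proof (rule closed_sequentially[OF closed_Nats])
    show "(\<lambda>N. (deriv ^^ n) (f N) 0 / fact n) \<longlonglongrightarrow> (deriv ^^ n) g 0 / fact n"
      by (intro tendsto_divide tendsto_const
            higher_deriv_complex_uniform_limit[OF assms(1)]) (use assms in auto)
    show "(deriv ^^ n) (f N) 0 / fact n \<in> \<nat>" for N
      using assms(4)[of N] fps_nth_fps_expansion unfolding nat_expansion_def by metis
  qed
  moreover have "g has_fps_expansion Abs_fps (\<lambda>n. (deriv ^^ n) g 0 / fact n)"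
  proof (rule has_fps_expansionI)
    have "eventually (\<lambda>z. z \<in> ball 0 r) (nhds (0::complex))"
      using assms(2) by (intro eventually_nhds_in_open) auto
    thus "eventually (\<lambda>z. (\<lambda>n. fps_nth (Abs_fps (\<lambda>n. (deriv ^^ n) g 0 / fact n)) n * z ^ n) sums g z) (nhds 0)"
    proof eventually_elim
      case (elim z)
      from holomorphic_power_series[OF assms(5) elim] show ?case by simp
    qed
  qed
  ultimately show ?thesis
    unfolding nat_expansion_def by (intro exI conjI) auto
qed

lemma nat_expansion_qpochhammer:
  assumes m: "m > 0"
  shows "nat_expansion (\<lambda>q. inverse (qpochhammer_inf (q ^ m) (q ^ m)))"
proof -
  have pow: "q ^ m \<in> ball 0 1" if "norm q < 1" for q :: complex
    using that m by (simp add: norm_power power_less_one_iff)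
  have pow': "q ^ m \<in> cball 0 (1/2)" if "q \<in> cball 0 (1/2)" for q :: complex
  proof -
    have "norm q ^ m \<le> norm q ^ 1"
      using that m by (intro power_decreasing) auto
    thus ?thesis using that by (simp add: norm_power)
  qed
  have hol: "(\<lambda>q. qpochhammer_inf (q ^ m) (q ^ m)) holomorphic_on ball 0 1"
  proof -
    have "((\<lambda>q. qpochhammer_inf q q) \<circ> (\<lambda>q. q ^ m)) holomorphic_on ball 0 1"
      by (rule holomorphic_on_compose_gen[OF _ holomorphic_qpochhammer])
         (use pow in \<open>auto intro!: holomorphic_intros\<close>)
    thus ?thesis by (simp add: o_def)
  qed
  have nz: "qpochhammer_inf (q ^ m) (q ^ m) \<noteq> 0" if "norm q < 1" for q
    using pow[OF that] by (intro qpochhammer_inf_nonzero) auto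
  have "continuous_on (cball 0 (1/2)) (\<lambda>q. norm (qpochhammer_inf (q ^ m) (q ^ m)))"
    by (intro continuous_on_norm holomorphic_on_imp_continuous_on holomorphic_on_subset[OF hol]) auto
  then obtain q0 where q0: "q0 \<in> cball 0 (1/2)"
    "\<And>q. q \<in> cball 0 (1/2) \<Longrightarrow>
       norm (qpochhammer_inf (q0 ^ m) (q0 ^ m)) \<le> norm (qpochhammer_inf (q ^ m) (q ^ m))"
    using continuous_attains_inf[of "cball 0 (1/2) :: complex set"
        "\<lambda>q. norm (qpochhammer_inf (q ^ m) (q ^ m))"] by auto
  have "uniform_limit (cball 0 (1/2)) (\<lambda>N q. \<Prod>k<N. 1 - q ^ m * (q ^ m) ^ k)
          (\<lambda>q. qpochhammer_inf (q ^ m) (q ^ m)) sequentially"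
    by (rule uniform_limit_compose'[OF uniform_limit_qpochhammer[of "1/2"]]) (use pow' in auto)
  hence "uniform_limit (cball 0 (1/2)) (\<lambda>N q. inverse (\<Prod>k<N. 1 - q ^ m * (q ^ m) ^ k))
          (inverse \<circ> (\<lambda>q. qpochhammer_inf (q ^ m) (q ^ m))) sequentially"
    by (rule uniform_lim_inverse[where b = "norm (qpochhammer_inf (q0 ^ m) (q0 ^ m))"])
       (use q0 nz[of q0] in auto)
  hence "uniform_limit (ball 0 (1/2)) (\<lambda>N q. inverse (\<Prod>k<N. 1 - q ^ m * (q ^ m) ^ k))
          (\<lambda>q. inverse (qpochhammer_inf (q ^ m) (q ^ m))) sequentially"
    unfolding o_def by (rule uniform_limit_on_subset) auto
  thus ?thesis
  proof (rule nat_expansion_limit)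
    fix N
    have "1 - q ^ m * (q ^ m) ^ k \<noteq> 0" if "q \<in> ball 0 (1/2)" for q :: complex and k
      using pow[of q] that by (intro qpochhammer_factor_nonzero) auto
    thus "(\<lambda>q. inverse (\<Prod>k<N. 1 - q ^ m * (q ^ m) ^ k)) holomorphic_on ball 0 (1/2)"
      by (intro holomorphic_intros) auto
    have "nat_expansion (\<lambda>q. \<Prod>k<N. inverse (1 - q ^ (m * Suc k)))"
      using m by (intro nat_expansion_prod nat_expansion_geometric) auto
    thus "nat_expansion (\<lambda>q. inverse (\<Prod>k<N. 1 - q ^ m * (q ^ m) ^ k))"
      by (simp add: prod_inversef[symmetric] power_mult power_add o_def)
    show "(\<lambda>q. inverse (qpochhammer_inf (q ^ m) (q ^ m))) holomorphic_on ball 0 (1/2)"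
      by (intro holomorphic_intros holomorphic_on_subset[OF hol]) (use nz in auto)
  qed auto
qed

lemma p33_generating_exists: "\<exists>c. p33_generating c"
proof -
  define g where "g q = 1 / (qpochhammer_inf q q ^ 3 * qpochhammer_inf (q ^ 3) (q ^ 3) ^ 3)" for q
  have pow: "q ^ 3 \<in> ball 0 1" if "norm q < 1" for q :: complex
    using that by (simp add: norm_power power_less_one_iff)
  have "((\<lambda>q. qpochhammer_inf q q) \<circ> (\<lambda>q. q ^ 3)) holomorphic_on ball 0 1"
    by (rule holomorphic_on_compose_gen[OF _ holomorphic_qpochhammer])
       (use pow in \<open>auto intro!: holomorphic_intros\<close>)
  hence hol: "g holomorphic_on ball 0 1"
    unfolding g_def o_def using pow
    by (intro holomorphic_intros holomorphic_qpochhammer)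
       (auto simp: qpochhammer_inf_nonzero)
  have "nat_expansion (\<lambda>q. inverse (qpochhammer_inf (q ^ 1) (q ^ 1)) ^ 3 *
                           inverse (qpochhammer_inf (q ^ 3) (q ^ 3)) ^ 3)"
    by (intro nat_expansion_mult nat_expansion_power nat_expansion_qpochhammer) auto
  also have "(\<lambda>q. inverse (qpochhammer_inf (q ^ 1) (q ^ 1)) ^ 3 *
                  inverse (qpochhammer_inf (q ^ 3) (q ^ 3)) ^ 3) = g"
    by (simp add: g_def fun_eq_iff field_simps)
  finally obtain F where F: "g has_fps_expansion F" "\<And>n. fps_nth F n \<in> \<nat>"
    unfolding nat_expansion_def by blast
  have "\<exists>c. \<forall>n. fps_nth F n = of_nat (c n)"
    using F(2) by (intro choice) (auto elim!: Nats_cases)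
  then obtain c where c: "\<And>n. fps_nth F n = of_nat (c n)" by blast
  have "(\<lambda>n. of_nat (c n) * q ^ n) sums g q" if "norm q < 1" for q
    using holomorphic_power_series[OF hol, of q] that
    by (simp add: fps_nth_fps_expansion[OF F(1), symmetric] c)
  thus ?thesis
    unfolding p33_generating_def g_def by blast
qed

lemma p33_generating_unique:
  assumes "p33_generating c" "p33_generating d"
  shows "c = d"
proof -
  define g where "g q = 1 / (qpochhammer_inf q q ^ 3 * qpochhammer_inf (q ^ 3) (q ^ 3) ^ 3)" for q
  have *: "g has_fps_expansion Abs_fps (\<lambda>n. of_nat (e n))" if "p33_generating e" for e
  proof (rule has_fps_expansionI)
    have "eventually (\<lambda>z. z \<in> ball 0 1) (nhds (0::complex))"
      by (intro eventually_nhds_in_open) auto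
    thus "eventually (\<lambda>z. (\<lambda>n. fps_nth (Abs_fps (\<lambda>n. of_nat (e n))) n * z ^ n) sums g z) (nhds 0)"
      by eventually_elim (use that in \<open>auto simp: p33_generating_def g_def\<close>)
  qed
  have "of_nat (c n) = (of_nat (d n) :: complex)" for n
    using fps_nth_fps_expansion[OF *[OF assms(1)], of n]
          fps_nth_fps_expansion[OF *[OF assms(2)], of n] by simp
  thus ?thesis by (auto simp: fun_eq_iff)
qed

theorem p33_generating_p33: "p33_generating p33"
  unfolding p33_def
  using p33_generating_exists p33_generating_unique by (metis theI')

end

theory Submission
  imports Defs
begin

text \<open>
  Let \<open>E\<close> denote Euler's product of all \<open>1 - q^k\<close> with \<open>k \<ge> 1\<close>. The generating function is the inverse
  of \<open>E(q)^3 E(q^3)^3\<close>, and every index in the theorem has the form \<open>9 k + 2\<close>. The proof has two halves.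

  Jacobi's identity writes \<open>E^3\<close> as the sum of \<open>(-1)^k (2k + 1) q^(k(k+1)/2)\<close>. Sorting the
  triangular numbers modulo 3 gives \<open>E(q)^3 = A(q^3) - 3 q E(q^9)^3\<close> for some series \<open>A\<close>
  (\<open>euler_cube_dissection\<close>). Rationalizing the denominator, as for a cube root, shows that the terms of
  the generating function with exponent \<open>3 n + 2\<close> are 9 times an integral series, modulo 27. That series
  matters only modulo 3, where it can be computed from \<open>E(q)^3 \<equiv> E(q^3)\<close>. The outcome
  (\<open>nine_k_plus_2_mod_27\<close>) is that \<open>p33 (9 k + 2)\<close> is congruent modulo 27 to 9 times the coefficient of
  \<open>q^k\<close> in \<open>E(q) E(q^3)\<close>.

  By the pentagonal number theorem \<open>E\<close> has a nonzero coefficient at \<open>n\<close> only if \<open>24 n + 1\<close> is a square.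
  So the coefficient of \<open>q^k\<close> in \<open>E(q) E(q^3)\<close> vanishes unless \<open>4 (6 k + 1) = x^2 + 3 y^2\<close> for some integers
  \<open>x\<close> and \<open>y\<close>. If \<open>-3\<close> is not a square modulo \<open>p\<close>, then \<open>p\<close> has an even exponent in every nonzero
  value of this form (\<open>inert_prime_odd_power\<close>), but in \<open>6 k + 1\<close> it has the exponent
  \<open>2 \<alpha> - 1\<close>. So the coefficient is 0, and 27 divides \<open>p33 (9 k + 2)\<close>.

  Both theta identities are obtained from finite versions that are proved by induction: Shanks'
  telescoping sum for the pentagonal numbers and a sum over Gaussian binomials for Jacobi's identity.
\<close>

section \<open>Congruences between formal power series\<close>

text \<open>
  Two kinds of congruence are used side by side: modulo an integer, which compares all coefficients
  modulo that integer, and modulo \<open>fps_X ^ n\<close>, which says that the first \<open>n\<close> coefficients agree.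
  Both are congruences modulo a principal ideal of the ring of power series.
\<close>

definition ring_cong :: "'a::comm_ring_1 \<Rightarrow> 'a \<Rightarrow> 'a \<Rightarrow> bool" where
  "ring_cong m a b \<longleftrightarrow> m dvd a - b"

lemma ring_cong_refl [simp, intro]: "ring_cong m a a"
  by (simp add: ring_cong_def)

lemma ring_cong_sym: "ring_cong m a b \<Longrightarrow> ring_cong m b a"
  unfolding ring_cong_def by (metis dvd_minus_iff minus_diff_eq)

lemma ring_cong_trans [trans]: "ring_cong m a b \<Longrightarrow> ring_cong m b c \<Longrightarrow> ring_cong m a c"
  unfolding ring_cong_def using dvd_add[of m "a - b" "b - c"] by simp

lemma ring_cong_add: "ring_cong m a b \<Longrightarrow> ring_cong m c d \<Longrightarrow> ring_cong m (a + c) (b + d)"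
  unfolding ring_cong_def using dvd_add[of m "a - b" "c - d"] by (simp add: algebra_simps)

lemma ring_cong_sum:
  "(\<And>x. x \<in> A \<Longrightarrow> ring_cong m (f x) (g x)) \<Longrightarrow> ring_cong m (sum f A) (sum g A)"
  by (induction A rule: infinite_finite_induct) (auto intro: ring_cong_add)

lemma ring_cong_mult:
  assumes "ring_cong m a b" "ring_cong m c d"
  shows "ring_cong m (a * c) (b * d)"
proof -
  have "a * c - b * d = (a - b) * c + b * (c - d)"
    by (simp add: algebra_simps)
  thus ?thesis
    using assms unfolding ring_cong_def by (metis dvd_add dvd_mult dvd_mult2)
qed

lemma ring_cong_power: "ring_cong m a b \<Longrightarrow> ring_cong m (a ^ n) (b ^ n)"
  by (induction n) (auto intro: ring_cong_mult)

lemma is_unit_fps: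
  fixes u :: "'a::comm_ring_1 fps"
  assumes "fps_nth u 0 = 1"
  shows "u dvd 1"
  using fps_left_inverse[of 1 u] assms by (intro dvdI[of _ _ "fps_left_inverse u 1"]) (simp add: mult.commute)

lemma ring_cong_cancel_unit:
  assumes "ring_cong m (u * a) (u * b)" "u dvd 1"
  shows "ring_cong m a b"
proof -
  from assms(2) obtain v where v: "u * v = 1" by (auto elim: dvdE)
  have "m dvd v * (u * a - u * b)"
    using assms(1) unfolding ring_cong_def by (rule dvd_mult)
  also have "v * (u * a - u * b) = (u * v) * (a - b)"
    by (simp add: algebra_simps)
  finally show ?thesis by (simp add: v ring_cong_def)
qed

lemma fps_X_power_dvd_iff:
  fixes f :: "'a::comm_ring_1 fps"
  shows "fps_X ^ n dvd f \<longleftrightarrow> (\<forall>i<n. fps_nth f i = 0)"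
proof
  assume "fps_X ^ n dvd f"
  thus "\<forall>i<n. fps_nth f i = 0" by (auto elim!: dvdE simp: fps_X_power_mult_nth)
next
  assume "\<forall>i<n. fps_nth f i = 0"
  hence "f = fps_X ^ n * fps_shift n f"
    by (intro fps_ext) (auto simp: fps_X_power_mult_nth)
  thus "fps_X ^ n dvd f" by (rule dvdI)
qed

lemma ring_cong_fps_X_power_iff:
  fixes f g :: "'a::comm_ring_1 fps"
  shows "ring_cong (fps_X ^ n) f g \<longleftrightarrow> (\<forall>i<n. fps_nth f i = fps_nth g i)"
  by (simp add: ring_cong_def fps_X_power_dvd_iff)

lemma fps_numeral_dvd_iff:
  fixes f :: "int fps"
  shows "numeral m dvd f \<longleftrightarrow> (\<forall>n. numeral m dvd fps_nth f n)"
proof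
  assume "\<forall>n. numeral m dvd fps_nth f n"
  hence "f = numeral m * Abs_fps (\<lambda>n. fps_nth f n div numeral m)"
    by (intro fps_ext) (auto simp: fps_mult_numeral_left)
  thus "numeral m dvd f" by (rule dvdI)
qed (auto elim!: dvdE simp: fps_mult_numeral_left)

lemma ring_cong_numeral_nth:
  fixes f g :: "int fps"
  shows "ring_cong (numeral m) f g \<longleftrightarrow> (\<forall>n. numeral m dvd fps_nth f n - fps_nth g n)"
  by (simp add: ring_cong_def fps_numeral_dvd_iff)

section \<open>Dilations and sections of a power series\<close>

definition dilate :: "nat \<Rightarrow> 'a::idom fps \<Rightarrow> 'a fps" where
  "dilate k f = fps_compose f (fps_X ^ k)"

lemma dilate_nth:
  "k > 0 \<Longrightarrow> fps_nth (dilate k f) n = (if k dvd n then fps_nth f (n div k) else 0)"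
  by (simp add: dilate_def fps_nth_compose_X_power)

lemma dilate_mult: "k > 0 \<Longrightarrow> dilate k (f * g) = dilate k f * dilate k g"
  unfolding dilate_def by (rule fps_compose_mult_distrib) auto

lemma dilate_1 [simp]: "dilate k 1 = 1"
  by (simp add: dilate_def)

lemma dilate_0 [simp]: "dilate k 0 = 0"
  by (simp add: dilate_def)

lemma dilate_uminus: "dilate k (- f) = - dilate k f"
  by (simp add: dilate_def fps_compose_uminus)

lemma dilate_diff: "dilate k (f - g) = dilate k f - dilate k g"
  by (simp add: dilate_def fps_compose_sub_distrib)

lemma dilate_power: "k > 0 \<Longrightarrow> dilate k (f ^ n) = dilate k f ^ n"
  by (induction n) (auto simp: dilate_mult)

lemma dilate_numeral [simp]: "k > 0 \<Longrightarrow> dilate k (numeral c) = numeral c"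
  by (intro fps_ext) (auto simp: dilate_nth fps_numeral_nth elim: dvdE)

lemma dilate_fps_X_power: "k > 0 \<Longrightarrow> dilate k (fps_X ^ n) = fps_X ^ (k * n)"
  by (intro fps_ext) (auto simp: dilate_nth fps_X_power_nth)

definition fps_section :: "nat \<Rightarrow> nat \<Rightarrow> 'a fps \<Rightarrow> 'a fps" where
  "fps_section k r f = Abs_fps (\<lambda>n. fps_nth f (k * n + r))"

lemma fps_section_nth [simp]: "fps_nth (fps_section k r f) n = fps_nth f (k * n + r)"
  by (simp add: fps_section_def)

lemma fps_section_add: "fps_section k r (f + g) = fps_section k r f + fps_section k r g"
  by (intro fps_ext) simp

lemma fps_section_X_power_dilate:
  assumes "r < k" "s < k"
  shows "fps_section k r (fps_X ^ s * dilate k f) = (if r = s then f else 0)"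
proof (intro fps_ext)
  fix n
  have "k * n + r < s \<or> \<not> k dvd (k * n + r - s)" if "r \<noteq> s"
  proof (rule ccontr)
    assume "\<not> ?thesis"
    hence "s \<le> k * n + r" "k dvd (k * n + r - s)" by auto
    hence "(k * n + r) mod k = s mod k"
      using mod_eq_dvd_iff_nat by blast
    with assms that show False by simp
  qed
  thus "fps_nth (fps_section k r (fps_X ^ s * dilate k f)) n = fps_nth (if r = s then f else 0) n"
    using assms by (auto simp: fps_X_power_mult_nth dilate_nth)
qed

text \<open>
  Sorting the exponents by residue class modulo \<open>k\<close>. Since the components are separated by
  \<open>fps_section_X_power_dilate\<close>, taking a section is linear over the series in \<open>q^k\<close>.
\<close>

lemma fps_section_decompose:
  assumes "k > 0"
  shows "f = (\<Sum>s<k. fps_X ^ s * dilate k (fps_section k s f))"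
proof (intro fps_ext)
  fix n
  have "n < s \<or> \<not> k dvd (n - s)" if "s < k" "s \<noteq> n mod k" for s
  proof (rule ccontr)
    assume "\<not> ?thesis"
    hence "s \<le> n" "k dvd (n - s)" by auto
    hence "n mod k = s mod k" using mod_eq_dvd_iff_nat by blast
    with that show False by simp
  qed
  hence "fps_nth (fps_X ^ s * dilate k (fps_section k s f)) n =
      (if s = n mod k then fps_nth f n else 0)" if "s < k" for s
    using that assms by (auto simp: fps_X_power_mult_nth dilate_nth minus_mod_eq_mult_div)
  thus "fps_nth f n = fps_nth (\<Sum>s<k. fps_X ^ s * dilate k (fps_section k s f)) n"
    using assms by (simp add: fps_sum_nth)
qed

lemma fps_section_mult_dilate:
  assumes "r < k"
  shows "fps_section k r (f * dilate k g) = fps_section k r f * g"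
proof -
  have k: "k > 0" using assms by simp
  have sum: "fps_section k r (sum h A) = (\<Sum>s\<in>A. fps_section k r (h s))"
    for h :: "nat \<Rightarrow> 'a fps" and A
    by (intro fps_ext) (simp add: fps_sum_nth)
  have "f * dilate k g = (\<Sum>s<k. fps_X ^ s * dilate k (fps_section k s f * g))"
    by (subst fps_section_decompose[OF k, of f])
       (simp add: sum_distrib_right dilate_mult[OF k] mult.assoc)
  hence "fps_section k r (f * dilate k g) =
      (\<Sum>s<k. fps_section k r (fps_X ^ s * dilate k (fps_section k s f * g)))"
    by (simp only: sum)
  also have "\<dots> = (\<Sum>s<k. if s = r then fps_section k s f * g else 0)"
    using assms by (intro sum.cong) (auto simp: fps_section_X_power_dilate)
  also have "\<dots> = fps_section k r f * g" using assms by simp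
  finally show ?thesis .
qed

section \<open>Euler's product and its finite truncations\<close>

definition qfac :: "nat \<Rightarrow> int fps" where
  "qfac n = (\<Prod>k=1..n. 1 - fps_X ^ k)"

definition euler_fps :: "int fps" where
  "euler_fps = Abs_fps (\<lambda>n. fps_nth (qfac n) n)"

lemma qfac_0 [simp]: "qfac 0 = 1"
  by (simp add: qfac_def)

lemma qfac_Suc: "qfac (Suc n) = qfac n * (1 - fps_X ^ Suc n)"
  by (simp add: qfac_def)

text \<open>
  The factors after the \<open>i\<close>-th do not change the coefficient of \<open>q^i\<close>, so \<open>euler_fps\<close>, which reads its
  \<open>n\<close>-th coefficient off the \<open>n\<close>-th partial product, is the limit of all partial products.
\<close>

lemma qfac_nth_stable: "i \<le> n \<Longrightarrow> fps_nth (qfac n) i = fps_nth (qfac i) i"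
proof (induction n rule: dec_induct)
  case (step n)
  have "qfac (Suc n) = qfac n - fps_X ^ Suc n * qfac n"
    by (simp add: qfac_Suc algebra_simps)
  thus ?case using step by (simp only: fps_sub_nth fps_X_power_mult_nth) auto
qed auto

lemma qfac_cong_euler:
  assumes "m \<le> Suc n"
  shows "ring_cong (fps_X ^ m) (qfac n) euler_fps"
  unfolding ring_cong_fps_X_power_iff euler_fps_def using assms by (auto intro: qfac_nth_stable)

lemma euler_nth_0 [simp]: "fps_nth euler_fps 0 = 1"
  by (simp add: euler_fps_def)

lemma is_unit_euler: "euler_fps dvd 1"
  by (rule is_unit_fps) simp

text \<open>
  The Frobenius congruence, which holds factor by factor: \<open>(1 - x)^3 - (1 - x^3) = 3 (x^2 - x)\<close>.
\<close>

lemma qfac_cube_mod_3: "ring_cong 3 (qfac n ^ 3) (dilate 3 (qfac n))"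
proof (induction n)
  case (Suc n)
  let ?x = "fps_X ^ Suc n :: int fps"
  have "(1 - ?x) ^ 3 - (1 - ?x ^ 3) = 3 * (?x ^ 2 - ?x)"
    by (simp add: algebra_simps power2_eq_square power3_eq_cube)
  hence "ring_cong 3 ((1 - ?x) ^ 3) (1 - ?x ^ 3)"
    unfolding ring_cong_def by (metis dvd_triv_left)
  moreover have "dilate 3 (1 - ?x) = 1 - ?x ^ 3"
    by (simp only: dilate_diff dilate_1 dilate_fps_X_power zero_less_numeral)
       (simp only: power_mult[symmetric] mult.commute)
  ultimately show ?case
    using Suc by (simp only: qfac_Suc power_mult_distrib dilate_mult zero_less_numeral ring_cong_mult)
qed (simp add: ring_cong_def)

lemma euler_cube_mod_3: "ring_cong 3 (euler_fps ^ 3) (dilate 3 euler_fps)"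
  unfolding ring_cong_numeral_nth
proof
  fix n
  have "ring_cong (fps_X ^ Suc n) (qfac n) euler_fps"
    by (rule qfac_cong_euler) simp
  hence "ring_cong (fps_X ^ Suc n) (qfac n ^ 3) (euler_fps ^ 3)"
    by (rule ring_cong_power)
  hence "fps_nth (euler_fps ^ 3) n = fps_nth (qfac n ^ 3) n"
    by (simp only: ring_cong_fps_X_power_iff)
  moreover have "fps_nth (dilate 3 euler_fps) n = fps_nth (dilate 3 (qfac n)) n"
    using qfac_nth_stable[of "n div 3" n] by (simp add: dilate_nth euler_fps_def)
  ultimately show "3 dvd fps_nth (euler_fps ^ 3) n - fps_nth (dilate 3 euler_fps) n"
    using qfac_cube_mod_3[of n] by (simp add: ring_cong_numeral_nth)
qed

section \<open>The support of Euler's product\<close>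

text \<open>
  Shanks' telescoping argument, in closed form for every partial sum. Passing from one \<open>s\<close> to the next
  uses \<open>P s = (1 - q^(s+1)) P (s+1)\<close>, which makes two of the three terms cancel.
\<close>

lemma shanks_telescope:
  fixes n :: nat
  defines "P \<equiv> (\<lambda>s. \<Prod>k\<in>{s<..n}. 1 - fps_X ^ k :: int fps)"
  assumes "m \<le> n"
  shows "(\<Sum>s\<le>m. (-1) ^ s * P s * fps_X ^ (s * n + triangle s) * ((1 - fps_X ^ Suc n) * fps_X ^ s - 1)) =
         - ((-1) ^ m * P m * fps_X ^ (Suc m * n + triangle (Suc m)))"
  using assms(2)
proof (induction m)
  case 0
  show ?case by simp
next
  case (Suc m)
  have "{m<..n} = insert (Suc m) {Suc m<..n}" using Suc.prems by auto
  hence P: "P m = (1 - fps_X ^ Suc m) * P (Suc m)"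
    unfolding P_def by (simp del: power_Suc)
  define x :: "int fps" where "x = fps_X ^ (Suc m * n + triangle (Suc m))"
  define y :: "int fps" where "y = fps_X ^ Suc m"
  define z :: "int fps" where "z = fps_X ^ Suc n"
  have e: "fps_X ^ (Suc (Suc m) * n + triangle (Suc (Suc m))) = x * (y * z)"
    unfolding x_def y_def z_def power_add[symmetric] by (simp add: algebra_simps)
  have "(\<Sum>s\<le>Suc m. (-1) ^ s * P s * fps_X ^ (s * n + triangle s) * ((1 - z) * fps_X ^ s - 1)) =
      - ((-1) ^ m * P m * x) + (-1) ^ Suc m * P (Suc m) * x * ((1 - z) * y - 1)"
    using Suc unfolding x_def y_def z_def by (simp del: power_Suc triangle_Suc)
  also have "\<dots> = - ((-1) ^ Suc m * P (Suc m) * (x * (y * z)))"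
    unfolding P y_def[symmetric] by (simp add: algebra_simps)
  finally show ?case unfolding e z_def .
qed

text \<open>
  A finite form of the pentagonal number theorem, due to Shanks. On the left, the summand for \<open>s = 0\<close>
  is the \<open>n\<close>-th partial product of Euler's product, and every other summand is divisible by
  \<open>q^(n+1)\<close>. On the right, \<open>k (k+1) + triangle (k+1)\<close> and \<open>(k+1)^2 + triangle (k+1)\<close> are
  the generalized pentagonal numbers \<open>m (3m - 1) / 2\<close> and \<open>m (3m + 1) / 2\<close> with \<open>m = k + 1\<close>.
\<close>

lemma shanks_identity:
  "(\<Sum>s\<le>n. (-1) ^ s * (\<Prod>k\<in>{s<..n}. 1 - fps_X ^ k :: int fps) * fps_X ^ (s * n + triangle s)) =
   1 + (\<Sum>k<n. (-1) ^ Suc k *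
          (fps_X ^ (Suc k * k + triangle (Suc k)) + fps_X ^ (Suc k * Suc k + triangle (Suc k))))"
proof (induction n)
  case (Suc n)
  define P where "P n s = (\<Prod>k\<in>{s<..n}. 1 - fps_X ^ k :: int fps)" for n s
  define t where "t n s = (-1) ^ s * P n s * fps_X ^ (s * n + triangle s)" for n s
  have P: "P (Suc n) s = (1 - fps_X ^ Suc n) * P n s" if "s \<le> n" for s
  proof -
    have "{s<..Suc n} = insert (Suc n) {s<..n}" using that by auto
    thus ?thesis unfolding P_def by (simp del: power_Suc)
  qed
  have "t (Suc n) s - t n s =
      (-1) ^ s * P n s * fps_X ^ (s * n + triangle s) * ((1 - fps_X ^ Suc n) * fps_X ^ s - 1)"
    if "s \<le> n" for s
  proof -
    have "fps_X ^ (s * Suc n + triangle s) = fps_X ^ (s * n + triangle s) * (fps_X ^ s :: int fps)"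
      by (simp add: power_add[symmetric] algebra_simps)
    thus ?thesis unfolding t_def P[OF that] by (simp only: algebra_simps mult_1_left mult_1_right)
  qed
  hence "(\<Sum>s\<le>n. t (Suc n) s - t n s) = - ((-1) ^ n * P n n * fps_X ^ (Suc n * n + triangle (Suc n)))"
    using shanks_telescope[of n n] by (simp add: P_def)
  moreover have "P m m = 1" for m by (simp add: P_def)
  ultimately have "(\<Sum>s\<le>Suc n. t (Suc n) s) = (\<Sum>s\<le>n. t n s) + (-1) ^ Suc n *
      (fps_X ^ (Suc n * n + triangle (Suc n)) + fps_X ^ (Suc n * Suc n + triangle (Suc n)))"
    by (simp add: sum_subtractf algebra_simps t_def[of "Suc n" "Suc n"] del: triangle_Suc)
  thus ?case using Suc by (simp add: t_def P_def algebra_simps)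
qed auto

lemma double_triangle: "2 * triangle k = k * Suc k"
  by (simp add: triangle_def)

text \<open>
  If \<open>n\<close> is a generalized pentagonal number \<open>m (3m + 1) / 2\<close>, \<open>m\<close> being an integer, then
  \<open>24 n + 1 = (6m + 1)^2\<close>.
\<close>

lemma euler_support:
  assumes "fps_nth euler_fps n \<noteq> 0"
  shows "\<exists>x::int. 24 * int n + 1 = x ^ 2"
proof (rule ccontr)
  assume no: "\<not> ?thesis"
  have sq: "24 * int (k * k + triangle k) + 1 = (6 * int k + 1) ^ 2" for k
    using arg_cong[OF double_triangle[of k], of int]
    by (simp add: power2_eq_square algebra_simps)
  have sq': "24 * int (Suc k * k + triangle (Suc k)) + 1 = (6 * int k + 5) ^ 2" for k
    using arg_cong[OF double_triangle[of "Suc k"], of int]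
    by (simp add: power2_eq_square algebra_simps del: triangle_Suc)
  have ne: "n \<noteq> Suc k * Suc k + triangle (Suc k)" "n \<noteq> Suc k * k + triangle (Suc k)" for k
    using no sq[of "Suc k"] sq'[of k] by blast+
  have n0: "n > 0" using no by (intro Nat.gr0I) (auto dest!: spec[of _ 1])
  have nth_term: "fps_nth ((-1) ^ j * (fps_X ^ a + fps_X ^ b) :: int fps) n = 0" if "n \<noteq> a" "n \<noteq> b" for j a b
    using that by (cases "even j") (auto simp: fps_X_power_nth)
  have "fps_nth (\<Sum>s\<le>n. (-1) ^ s * (\<Prod>k\<in>{s<..n}. 1 - fps_X ^ k :: int fps) * fps_X ^ (s * n + triangle s)) n = 0"
    unfolding shanks_identity using n0 ne
    by (simp add: fps_sum_nth nth_term del: triangle_Suc power_Suc mult_Suc)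
  moreover have "fps_nth ((-1) ^ s * (\<Prod>k\<in>{s<..n}. 1 - fps_X ^ k :: int fps) * fps_X ^ (s * n + triangle s)) n =
        (if s = 0 then fps_nth euler_fps n else 0)" for s
  proof (cases s)
    case 0
    have "{0<..n} = {1..n}" by auto
    thus ?thesis using 0 by (simp add: euler_fps_def qfac_def)
  next
    case (Suc r)
    hence "n < s * n + triangle s" by simp
    thus ?thesis using Suc by (simp only: fps_X_power_mult_right_nth) simp
  qed
  ultimately show False using assms by (simp add: fps_sum_nth)
qed

section \<open>Jacobi's identity for the cube of Euler's product\<close>

text \<open>
  This is the Gaussian binomial coefficient \<open>[2n + 1, n - k]\<close>; the recursion comes from using the
  \<open>q\<close>-Pascal rule twice. For \<open>k = 0\<close> the truncated \<open>k - 1\<close> is \<open>0\<close>, which is the right value because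
  \<open>[2n + 1, n + 1] = [2n + 1, n]\<close>.
\<close>

fun odd_gauss_binomial :: "nat \<Rightarrow> nat \<Rightarrow> int fps" where
  "odd_gauss_binomial 0 k = (if k = 0 then 1 else 0)"
| "odd_gauss_binomial (Suc n) k =
     fps_X ^ (Suc n - k) * odd_gauss_binomial n (k - 1)
     + (1 + fps_X ^ (2 * n + 2)) * odd_gauss_binomial n k
     + fps_X ^ (n + 2 + k) * odd_gauss_binomial n (Suc k)"

lemma odd_gauss_binomial_eq_0: "k > n \<Longrightarrow> odd_gauss_binomial n k = 0"
  by (induction n arbitrary: k) auto

text \<open>
  A finite form of Jacobi's identity. In the recursion for \<open>n + 1\<close> the outer terms, shifted by one
  in \<open>k\<close>, all carry the same power \<open>q^(triangle k + n + 1)\<close>. Their weights add up to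
  \<open>s (k+1) + s (k-1) = - 2 s k\<close>, because \<open>(-1)^k s k\<close> is linear in \<open>k\<close>. So every summand is
  multiplied by \<open>1 - 2 q^(n+1) + q^(2n+2) = (1 - q^(n+1))^2\<close>.
\<close>

lemma jacobi_finite:
  "(\<Sum>k\<le>n. of_int ((-1) ^ k * (2 * int k + 1)) * fps_X ^ triangle k * odd_gauss_binomial n k) = qfac n ^ 2"
proof (induction n)
  case (Suc n)
  define g where "g = odd_gauss_binomial n"
  define z :: "int fps" where "z = fps_X ^ Suc n"
  define s :: "nat \<Rightarrow> int fps" where "s k = of_int ((-1) ^ k * (2 * int k + 1))" for k
  \<comment> \<open>The weight \<open>s (k - 1)\<close>, written so that it makes sense at \<open>k = 0\<close>, where the reflection \<open>k \<mapsto> - 1 - k\<close> gives it the value \<open>1\<close>.\<close>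
  define s' :: "nat \<Rightarrow> int fps" where "s' k = of_int (- ((-1) ^ k * (2 * int k - 1)))" for k
  define H where "H i = s' i * z * fps_X ^ triangle i * g i" for i
  have z2: "fps_X ^ (2 * n + 2) = z * z"
    unfolding z_def power_add[symmetric] by (simp add: algebra_simps)
  have 1: "s (Suc i) * fps_X ^ triangle (Suc i) * (fps_X ^ (Suc n - Suc i) * g (Suc i - 1)) =
      s (Suc i) * z * fps_X ^ triangle i * g i" if "i \<le> n" for i
  proof -
    have "triangle (Suc i) + (Suc n - Suc i) = Suc n + triangle i" using that by simp
    hence "fps_X ^ triangle (Suc i) * fps_X ^ (Suc n - Suc i) = z * (fps_X ^ triangle i :: int fps)"
      unfolding z_def power_add[symmetric] by (simp only:)
    thus ?thesis unfolding diff_Suc_1 by (metis mult.assoc)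
  qed
  have sum1: "(\<Sum>k\<le>Suc n. s k * fps_X ^ triangle k * (fps_X ^ (Suc n - k) * g (k - 1))) =
      z * g 0 + (\<Sum>i\<le>n. s (Suc i) * z * fps_X ^ triangle i * g i)"
    unfolding sum.atMost_Suc_shift
  proof (rule arg_cong2[where f = "(+)"])
    show "s 0 * fps_X ^ triangle 0 * (fps_X ^ (Suc n - 0) * g (0 - 1)) = z * g 0"
      by (simp add: s_def z_def)
  qed (rule sum.cong[OF refl], rule 1, simp)
  have 3: "s k * fps_X ^ triangle k * (fps_X ^ (n + 2 + k) * g (Suc k)) = H (Suc k)" for k
  proof -
    have "triangle k + (n + 2 + k) = Suc n + triangle (Suc k)" by simp
    hence "fps_X ^ triangle k * fps_X ^ (n + 2 + k) = z * (fps_X ^ triangle (Suc k) :: int fps)"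
      unfolding z_def power_add[symmetric] by (simp only:)
    moreover have "s k = s' (Suc k)" by (simp add: s_def s'_def)
    ultimately show ?thesis unfolding H_def by (metis mult.assoc)
  qed
  have "(\<Sum>k\<le>Suc n. H (Suc k)) + H 0 = (\<Sum>k\<le>Suc (Suc n). H k)"
    by (subst (2) sum.atMost_Suc_shift) (simp add: add.commute)
  also have "\<dots> = (\<Sum>k\<le>n. H k)"
    by (simp add: H_def g_def odd_gauss_binomial_eq_0)
  finally have sum3: "(\<Sum>k\<le>Suc n. H (Suc k)) = (\<Sum>k\<le>n. H k) - z * g 0"
    by (simp add: H_def s'_def algebra_simps)
  have sum2: "(\<Sum>k\<le>Suc n. s k * fps_X ^ triangle k * ((1 + z * z) * g k)) =
      (\<Sum>k\<le>n. s k * fps_X ^ triangle k * ((1 + z * z) * g k))"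
    by (simp add: g_def odd_gauss_binomial_eq_0)
  have s: "s (Suc k) + s' k = - (2 * s k)" for k
  proof -
    have "s (Suc k) + s' k = of_int ((-1) ^ Suc k * (2 * int (Suc k) + 1) + - ((-1) ^ k * (2 * int k - 1)))"
      by (simp only: s_def s'_def of_int_add)
    also have "(-1) ^ Suc k * (2 * int (Suc k) + 1) + - ((-1) ^ k * (2 * int k - 1)) =
        - (2 * ((-1) ^ k * (2 * int k + 1)))"
      by (simp add: algebra_simps)
    finally show ?thesis by (simp add: s_def)
  qed
  have "(\<Sum>k\<le>Suc n. s k * fps_X ^ triangle k * odd_gauss_binomial (Suc n) k) =
      (\<Sum>k\<le>Suc n. s k * fps_X ^ triangle k * (fps_X ^ (Suc n - k) * g (k - 1)))
      + (\<Sum>k\<le>Suc n. s k * fps_X ^ triangle k * ((1 + z * z) * g k))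
      + (\<Sum>k\<le>Suc n. s k * fps_X ^ triangle k * (fps_X ^ (n + 2 + k) * g (Suc k)))"
    by (simp only: odd_gauss_binomial.simps g_def z2 distrib_left sum.distrib)
  also have "\<dots> = (\<Sum>i\<le>n. s (Suc i) * z * fps_X ^ triangle i * g i)
      + (\<Sum>k\<le>n. s k * fps_X ^ triangle k * ((1 + z * z) * g k)) + (\<Sum>k\<le>n. H k)"
    by (simp only: sum1 sum2 sum3 3) simp
  also have "\<dots> = (\<Sum>i\<le>n. fps_X ^ triangle i * g i * (s i * (1 + z * z) + z * (s (Suc i) + s' i)))"
    unfolding sum.distrib[symmetric] H_def by (intro sum.cong refl) (simp only: algebra_simps)
  also have "\<dots> = (\<Sum>i\<le>n. s i * fps_X ^ triangle i * g i) * (1 - z) ^ 2"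
    unfolding s sum_distrib_right by (intro sum.cong refl) (simp add: algebra_simps power2_eq_square)
  also have "\<dots> = qfac (Suc n) ^ 2"
    using Suc by (simp only: s_def g_def qfac_Suc z_def power_mult_distrib)
  finally show ?case by (simp only: s_def)
qed auto

text \<open>
  The product formula for Gaussian binomials. With \<open>a = n + 1 - k\<close> and \<open>c = n + 1 + k\<close>, after the
  common factor is taken out, the recursion reduces to an identity in \<open>A = q^a\<close> and \<open>C = q^c\<close>.
\<close>

lemma odd_gauss_binomial_qfac:
  "k \<le> n \<Longrightarrow> odd_gauss_binomial n k * qfac (n - k) * qfac (n + k + 1) = qfac (2 * n + 1)"
proof (induction n arbitrary: k)
  case (Suc n)
  define g where "g = odd_gauss_binomial n"
  define Q where "Q = qfac (2 * n + 1)"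
  define a where "a = Suc n - k"
  define c where "c = n + k + 1"
  have IH: "g i * qfac (n - i) * qfac (n + i + 1) = Q" if "i \<le> n" for i
    using Suc.IH[OF that] by (simp add: g_def Q_def)
  have ac: "a + c = 2 * n + 2" using Suc.prems by (simp add: a_def c_def)
  have rearrange: "x * (y * u) * (z * v) = u * v * (x * y * z)" for x y z u v :: "int fps"
    by (simp only: mult_ac)
  have 1: "g (k - 1) * qfac a * qfac (Suc c) = (1 - fps_X ^ c) * (1 - fps_X ^ Suc c) * Q"
  proof (cases k)
    case 0
    have "g 0 * qfac n * qfac (Suc n) = Q" using IH[of 0] by simp
    moreover have "g 0 * qfac (Suc n) * qfac (Suc (Suc n)) =
        (1 - fps_X ^ Suc n) * (1 - fps_X ^ Suc (Suc n)) * (g 0 * qfac n * qfac (Suc n))"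
      by (simp only: qfac_Suc mult_ac)
    ultimately show ?thesis by (simp add: 0 a_def c_def del: power_Suc)
  next
    case (Suc i)
    have "g i * qfac a * qfac (n + k) = Q" using IH[of i] Suc Suc.prems by (simp add: a_def)
    moreover have "qfac (Suc c) = qfac (n + k) * ((1 - fps_X ^ c) * (1 - fps_X ^ Suc c))"
      by (simp only: c_def Suc_eq_plus1[symmetric] qfac_Suc mult.assoc)
    moreover have "g (k - 1) * qfac a * (q * r) = r * (g (k - 1) * qfac a * q)" for q r
      by (simp only: mult_ac)
    ultimately show ?thesis by (simp only: Suc diff_Suc_1)
  qed
  have 2: "g k * qfac a * qfac (Suc c) = (1 - fps_X ^ a) * (1 - fps_X ^ Suc c) * Q"
  proof (cases "k \<le> n")
    case True
    hence "qfac a = qfac (n - k) * (1 - fps_X ^ a)"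
      by (simp only: a_def Suc_diff_le qfac_Suc)
    moreover have "g k * qfac (n - k) * qfac c = Q" using IH[OF True] by (simp add: c_def)
    ultimately show ?thesis by (simp only: qfac_Suc[of c] rearrange)
  qed (use Suc.prems in \<open>auto simp: g_def a_def odd_gauss_binomial_eq_0\<close>)
  have 3: "g (Suc k) * qfac a * qfac (Suc c) = (1 - fps_X ^ a) * (1 - fps_X ^ (a - 1)) * Q"
  proof (cases "Suc k \<le> n")
    case True
    hence a: "a = Suc (Suc (n - Suc k))" by (simp add: a_def)
    have "qfac a = qfac (n - Suc k) * ((1 - fps_X ^ (a - 1)) * (1 - fps_X ^ a))"
      by (simp only: a diff_Suc_1 qfac_Suc mult.assoc)
    moreover have "g (Suc k) * qfac (n - Suc k) * qfac (Suc c) = Q" using IH[OF True] by (simp add: c_def)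
    moreover have "x * (y * (u * v)) * z = v * u * (x * y * z)" for x y z u v :: "int fps"
      by (simp only: mult_ac)
    ultimately show ?thesis by (simp only:)
  next
    case False
    hence "a = 0 \<or> a = 1" by (auto simp: a_def)
    with False show ?thesis by (auto simp: g_def odd_gauss_binomial_eq_0)
  qed
  define A C :: "int fps" where "A = fps_X ^ a" and "C = fps_X ^ c"
  have AC: "fps_X ^ (2 * n + 2) = A * C" by (simp only: A_def C_def power_add[symmetric] ac)
  have C': "fps_X ^ Suc c = fps_X * C" by (simp add: C_def)
  have "odd_gauss_binomial (Suc n) k * qfac a * qfac (Suc c) =
      A * (g (k - 1) * qfac a * qfac (Suc c)) + (1 + A * C) * (g k * qfac a * qfac (Suc c))
      + fps_X ^ Suc c * (g (Suc k) * qfac a * qfac (Suc c))"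
  proof -
    have "n + 2 + k = Suc c" by (simp add: c_def)
    thus ?thesis
      by (simp only: odd_gauss_binomial.simps g_def[symmetric] AC A_def[symmetric] a_def[symmetric])
         (simp only: algebra_simps)
  qed
  also have "\<dots> = Q * (A * (1 - C) * (1 - fps_X * C) + (1 + A * C) * (1 - A) * (1 - fps_X * C)
      + fps_X * C * (1 - A) * (1 - fps_X ^ (a - 1)))"
    by (simp only: 1 2 3 C' A_def[symmetric] C_def[symmetric]) (simp only: algebra_simps)
  also have "fps_X * C * (1 - A) * (1 - fps_X ^ (a - 1)) = C * (1 - A) * (fps_X - A)"
    by (cases a) (simp_all add: A_def algebra_simps)
  also have "A * (1 - C) * (1 - fps_X * C) + (1 + A * C) * (1 - A) * (1 - fps_X * C)
      + C * (1 - A) * (fps_X - A) = (1 - A * C) * (1 - fps_X * (A * C))"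
    by (simp add: algebra_simps)
  also have "Q * \<dots> = qfac (2 * n + 1) * (1 - fps_X ^ Suc (2 * n + 1)) * (1 - fps_X ^ Suc (Suc (2 * n + 1)))"
    by (simp only: AC[symmetric] Q_def power_Suc) (simp add: algebra_simps)
  also have "\<dots> = qfac (2 * Suc n + 1)" by (simp only: qfac_Suc[symmetric]) simp
  finally show ?case by (simp add: a_def c_def)
qed (auto simp: qfac_Suc)

text \<open>
  As \<open>n\<close> grows, \<open>[2n + 1, n - k]\<close> tends to the inverse of Euler's product; all the factors in the
  product formula agree with Euler's product up to degree \<open>n - k\<close>.
\<close>

lemma odd_gauss_binomial_cong:
  assumes "k \<le> n"
  shows "ring_cong (fps_X ^ Suc (n - k)) (odd_gauss_binomial n k * euler_fps) 1"
proof -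
  let ?M = "fps_X ^ Suc (n - k) :: int fps" and ?g = "odd_gauss_binomial n k"
  have "ring_cong ?M (?g * qfac (n - k) * qfac (n + k + 1)) (?g * euler_fps * euler_fps)"
    by (intro ring_cong_mult qfac_cong_euler ring_cong_refl) auto
  hence "ring_cong ?M (?g * euler_fps * euler_fps) (qfac (2 * n + 1))"
    unfolding odd_gauss_binomial_qfac[OF assms] by (rule ring_cong_sym)
  also have "ring_cong ?M (qfac (2 * n + 1)) euler_fps"
    by (rule qfac_cong_euler) auto
  finally have "ring_cong ?M (euler_fps * (?g * euler_fps)) (euler_fps * 1)"
    by (simp add: mult_ac del: power_Suc)
  thus ?thesis by (rule ring_cong_cancel_unit[OF _ is_unit_euler])
qed

lemma triangle_ge: "k \<le> triangle k"
  by (induction k) auto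

text \<open>
  Multiplying \<open>jacobi_finite\<close> by Euler's product turns its right-hand side into the cube. On the left the
  Gaussian binomial cancels up to degree \<open>n - k\<close>, and the prefactor \<open>q^(triangle k)\<close>, with
  \<open>triangle k \<ge> k\<close>, raises this to degree \<open>n\<close>.
\<close>

lemma jacobi_cube_identity:
  "ring_cong (fps_X ^ Suc n) (euler_fps ^ 3)
     (\<Sum>k\<le>n. of_int ((-1) ^ k * (2 * int k + 1)) * fps_X ^ triangle k)"
proof -
  let ?M = "fps_X ^ Suc n :: int fps"
  define s :: "nat \<Rightarrow> int fps" where "s k = of_int ((-1) ^ k * (2 * int k + 1))" for k
  have summand: "ring_cong ?M (s k * fps_X ^ triangle k * odd_gauss_binomial n k * euler_fps)
      (s k * fps_X ^ triangle k)" if "k \<le> n" for k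
  proof -
    have "Suc n \<le> triangle k + Suc (n - k)" using triangle_ge[of k] that by simp
    hence "?M dvd fps_X ^ (triangle k + Suc (n - k))" by (rule le_imp_power_dvd)
    also have "\<dots> dvd fps_X ^ triangle k * (odd_gauss_binomial n k * euler_fps - 1)"
      using odd_gauss_binomial_cong[OF that] unfolding ring_cong_def power_add
      by (rule mult_dvd_mono[OF dvd_refl])
    also have "\<dots> dvd s k * fps_X ^ triangle k * odd_gauss_binomial n k * euler_fps
        - s k * fps_X ^ triangle k"
      by (rule dvdI[of _ _ "s k"]) (simp only: algebra_simps mult_1_left mult_1_right)
    finally show ?thesis unfolding ring_cong_def .
  qed
  have "ring_cong ?M (euler_fps ^ 3) (qfac n ^ 2 * euler_fps)"
  proof -
    have "ring_cong ?M (qfac n ^ 2 * euler_fps) (euler_fps ^ 2 * euler_fps)"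
      by (intro ring_cong_mult ring_cong_power qfac_cong_euler ring_cong_refl) auto
    moreover have "euler_fps ^ 2 * euler_fps = euler_fps ^ 3" by (simp add: eval_nat_numeral)
    ultimately show ?thesis by (simp add: ring_cong_sym)
  qed
  also have "qfac n ^ 2 * euler_fps =
      (\<Sum>k\<le>n. s k * fps_X ^ triangle k * odd_gauss_binomial n k * euler_fps)"
    unfolding jacobi_finite[symmetric] s_def by (simp only: sum_distrib_right)
  also have "ring_cong ?M \<dots> (\<Sum>k\<le>n. s k * fps_X ^ triangle k)"
    by (intro ring_cong_sum summand) auto
  finally show ?thesis unfolding s_def .
qed

lemma jacobi_nth_triangle:
  "fps_nth (euler_fps ^ 3) (triangle k) = (-1) ^ k * (2 * int k + 1)" (is ?on)
  and jacobi_nth_not_triangle: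
  "n \<notin> range triangle \<Longrightarrow> fps_nth (euler_fps ^ 3) n = 0" (is "_ \<Longrightarrow> ?off")
proof -
  have inj: "inj triangle"
    by (intro strict_mono_imp_inj_on strict_monoI_Suc) simp
  have c: "fps_nth (of_int c * fps_X ^ j) n = (if n = j then c else 0)" for c :: int and j n
    unfolding fps_of_int[symmetric] by (simp add: fps_X_power_nth)
  have nth: "fps_nth (euler_fps ^ 3) n = (\<Sum>k\<le>n. if n = triangle k then (-1) ^ k * (2 * int k + 1) else 0)" for n
    using jacobi_cube_identity[of n] unfolding ring_cong_fps_X_power_iff fps_sum_nth c by blast
  show ?on
    using inj triangle_ge[of k] unfolding nth by (simp add: inj_eq if_distrib)
  show ?off if "n \<notin> range triangle"
    unfolding nth using that by (intro sum.neutral) auto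
qed

section \<open>The arithmetic progression \<open>9 k + 2\<close> modulo 27\<close>

text \<open>
  Triangular numbers are congruent to 0 or 1 modulo 3. Those congruent to 1 are
  \<open>triangle (3m + 1) = 9 triangle m + 1\<close>, and Jacobi's coefficient there is
  \<open>(-1)^(3m+1) (6m + 3) = - 3 (-1)^m (2m + 1)\<close>, which is \<open>- 3\<close> times the coefficient at \<open>triangle m\<close>.
  So the cube of Euler's product reappears in its own dissection, at \<open>q^9\<close>.
\<close>

lemma euler_cube_dissection:
  defines "A \<equiv> fps_section 3 0 (euler_fps ^ 3)"
  shows "euler_fps ^ 3 = dilate 3 A - 3 * fps_X * dilate 3 (dilate 3 (euler_fps ^ 3))"
proof -
  have mod3: "triangle (3 * m) mod 3 = 0" "triangle (3 * m + 1) = 9 * triangle m + 1"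
     "triangle (3 * m + 2) mod 3 = 0" for m
  proof -
    have "2 * triangle (3 * m + 1) = 2 * (9 * triangle m + 1)"
      using double_triangle[of m] double_triangle[of "3 * m + 1"] by (simp add: algebra_simps)
    thus "triangle (3 * m + 1) = 9 * triangle m + 1" by simp
    have "2 * triangle (3 * m) = 2 * (9 * triangle m) - 2 * (3 * m)"
      using double_triangle[of m] double_triangle[of "3 * m"] by (simp add: algebra_simps)
    hence "triangle (3 * m) = 9 * triangle m - 3 * m" by simp
    also have "\<dots> = 3 * (3 * triangle m - m)" by simp
    finally show "triangle (3 * m) mod 3 = 0" by simp
    have "triangle (3 * m + 2) = 3 * (3 * triangle m + m + 1)"
      using \<open>triangle (3 * m + 1) = _\<close> by simp
    thus "triangle (3 * m + 2) mod 3 = 0" by (simp only: mod_mult_self1_is_0)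
  qed
  have cases3: "\<exists>m. k = 3 * m \<or> k = 3 * m + 1 \<or> k = 3 * m + 2" for k :: nat
    by presburger
  have one_mod_3: "\<exists>m. k = 3 * m + 1" if "triangle k mod 3 = 1" for k
    using cases3[of k] mod3 that by (metis zero_neq_one)
  have not_two_mod_3: "triangle k mod 3 \<noteq> 2" for k
  proof -
    obtain m where "k = 3 * m \<or> k = 3 * m + 1 \<or> k = 3 * m + 2" using cases3 by blast
    moreover have "triangle (3 * m + 1) mod 3 = 1" unfolding mod3(2) by presburger
    ultimately have "triangle k mod 3 = 0 \<or> triangle k mod 3 = 1" using mod3(1,3)[of m] by metis
    thus ?thesis by auto
  qed
  have "fps_section 3 2 (euler_fps ^ 3) = 0"
  proof (intro fps_ext)
    fix n
    have "3 * n + 2 \<notin> range triangle"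
    proof
      assume "3 * n + 2 \<in> range triangle"
      then obtain k where "triangle k = 3 * n + 2" by auto
      moreover have "(3 * n + 2) mod 3 = 2" by presburger
      ultimately show False using not_two_mod_3[of k] by simp
    qed
    thus "fps_nth (fps_section 3 2 (euler_fps ^ 3)) n = fps_nth 0 n"
      by (simp add: jacobi_nth_not_triangle)
  qed
  moreover have "fps_section 3 1 (euler_fps ^ 3) = - (3 * dilate 3 (euler_fps ^ 3))"
  proof (intro fps_ext)
    fix n
    have "fps_nth (euler_fps ^ 3) (3 * n + 1) = - 3 * fps_nth (dilate 3 (euler_fps ^ 3)) n"
    proof (cases "3 * n + 1 \<in> range triangle")
      case True
      then obtain k where k: "triangle k = 3 * n + 1" by auto
      have "triangle k mod 3 = 1" unfolding k by presburger
      then obtain m where m: "k = 3 * m + 1" using one_mod_3 by blast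
      have n: "n = 3 * triangle m" using k mod3(2)[of m] m by simp
      show ?thesis
        unfolding k[symmetric] jacobi_nth_triangle unfolding n m
        by (simp add: dilate_nth jacobi_nth_triangle uminus_power_if)
    next
      case False
      have "n div 3 \<notin> range triangle" if "3 dvd n"
      proof
        assume "n div 3 \<in> range triangle"
        then obtain m where "n div 3 = triangle m" by auto
        hence "triangle (3 * m + 1) = 3 * n + 1" using that mod3(2)[of m] by auto
        with False show False by (metis rangeI)
      qed
      thus ?thesis using False by (simp add: dilate_nth jacobi_nth_not_triangle)
    qed
    thus "fps_nth (fps_section 3 1 (euler_fps ^ 3)) n = fps_nth (- (3 * dilate 3 (euler_fps ^ 3))) n"
      by (simp add: fps_mult_numeral_left)
  qed
  moreover have "{..<3::nat} = {0, 1, 2}" by auto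
  hence "euler_fps ^ 3 = dilate 3 A + fps_X * dilate 3 (fps_section 3 1 (euler_fps ^ 3))
      + fps_X ^ 2 * dilate 3 (fps_section 3 2 (euler_fps ^ 3))"
    using fps_section_decompose[of 3 "euler_fps ^ 3"] by (simp add: A_def add.assoc)
  ultimately show ?thesis
    by (simp only: dilate_0 dilate_uminus dilate_mult dilate_numeral zero_less_numeral)
       (simp only: mult_zero_left mult_zero_right add_0_right mult_minus_right mult_ac diff_conv_add_uminus)
qed

text \<open>
  By the dissection, \<open>E^3 = a - 3 q b\<close> with series \<open>a\<close> and \<open>b\<close> in \<open>q^3\<close>. Multiplying by
  \<open>a^2 + 3 q a b + 9 q^2 b^2\<close> gives \<open>a^3 - 27 q^3 b^3\<close>, which is also a series in \<open>q^3\<close>, so the exponents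
  \<open>3n + 2\<close> of \<open>1 / E^3\<close> come from \<open>9 q^2 b^2\<close> alone. The factor 9 means that everything else is needed
  modulo 3 only, where cubing is the substitution of \<open>q^3\<close> for \<open>q\<close>: with \<open>A\<close> congruent to \<open>E\<close>, the
  quotient of \<open>E(q^3)^6\<close> by \<open>A^3 E^3\<close> becomes \<open>E(q^3)^4\<close>.
\<close>

lemma section_2_mod_27:
  fixes C :: "int fps"
  assumes C: "C * euler_fps ^ 3 * dilate 3 euler_fps ^ 3 = 1"
  shows "ring_cong 27 (fps_section 3 2 C) (9 * dilate 3 (euler_fps ^ 4))"
proof -
  let ?E = euler_fps
  define A where "A = fps_section 3 0 (?E ^ 3)"
  define B where "B = dilate 3 (?E ^ 3)"
  define a b where "a = dilate 3 A" and "b = dilate 3 B"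
  have E3: "?E ^ 3 = a - 3 * fps_X * b"
    using euler_cube_dissection by (simp add: A_def B_def a_def b_def)
  \<comment> \<open>Modulo 3 the section of \<open>E^3\<close> is the section of \<open>E(q^3)\<close>.\<close>
  have "ring_cong 3 A ?E"
    unfolding ring_cong_numeral_nth
  proof
    fix n
    have "fps_nth (dilate 3 ?E) (3 * n) = fps_nth ?E n" by (simp add: dilate_nth)
    thus "3 dvd fps_nth A n - fps_nth ?E n"
      using euler_cube_mod_3 unfolding ring_cong_numeral_nth A_def by (metis fps_section_nth add_0_right)
  qed
  have section_2: "fps_section 3 2 (fps_X ^ 0 * dilate 3 f) = 0" "fps_section 3 2 (fps_X ^ 1 * dilate 3 f) = 0"
    "fps_section 3 2 (fps_X ^ 2 * dilate 3 f) = f" for f :: "int fps"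
    by (subst fps_section_X_power_dilate; simp)+
  define e where "e = dilate 3 ?E ^ 3"
  have e: "e = dilate 3 (?E ^ 3)" by (simp add: e_def dilate_power)
  have "C * (?E ^ 3 * (a\<^sup>2 + 3 * fps_X * a * b + 9 * fps_X\<^sup>2 * b\<^sup>2)) * e =
      (C * ?E ^ 3 * e) * (a\<^sup>2 + 3 * fps_X * a * b + 9 * fps_X\<^sup>2 * b\<^sup>2)"
    by (simp only: mult_ac)
  also have "?E ^ 3 * (a\<^sup>2 + 3 * fps_X * a * b + 9 * fps_X\<^sup>2 * b\<^sup>2) = a ^ 3 - 27 * (fps_X ^ 3 * b ^ 3)"
    unfolding E3 by (simp add: algebra_simps power2_eq_square power3_eq_cube)
  also have "C * ?E ^ 3 * e = 1" using C by (simp add: e_def)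
  finally have "C * (a ^ 3 * e) =
      (a\<^sup>2 + 3 * fps_X * a * b + 9 * fps_X\<^sup>2 * b\<^sup>2) + 27 * (C * (fps_X ^ 3 * b ^ 3) * e)"
    by (simp add: algebra_simps)
  hence "C * dilate 3 (A ^ 3 * ?E ^ 3) =
      (fps_X ^ 0 * dilate 3 (A\<^sup>2) + fps_X ^ 1 * dilate 3 (3 * A * B) + fps_X ^ 2 * dilate 3 (9 * B\<^sup>2))
      + C * dilate 3 (27 * (fps_X * B ^ 3 * ?E ^ 3))"
    unfolding e a_def b_def
    by (simp add: dilate_mult dilate_power dilate_fps_X_power[of 3 1, simplified] algebra_simps
        del: power_0_left)
  hence "fps_section 3 2 (C * dilate 3 (A ^ 3 * ?E ^ 3)) =
      9 * B\<^sup>2 + fps_section 3 2 (C * dilate 3 (27 * (fps_X * B ^ 3 * ?E ^ 3)))"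
    by (simp only: fps_section_add section_2 add_0_left)
  hence "fps_section 3 2 C * (A ^ 3 * ?E ^ 3) =
      9 * B\<^sup>2 + fps_section 3 2 C * (27 * (fps_X * B ^ 3 * ?E ^ 3))"
    by (simp add: fps_section_mult_dilate)
  hence main: "ring_cong 27 (fps_section 3 2 C * (A ^ 3 * ?E ^ 3)) (9 * B\<^sup>2)"
    unfolding ring_cong_def by simp
  have "ring_cong 27 (9 * dilate 3 (?E ^ 4) * (A ^ 3 * ?E ^ 3)) (9 * B\<^sup>2)"
  proof -
    have "ring_cong 3 (dilate 3 (?E ^ 4) * (A ^ 3 * ?E ^ 3)) (dilate 3 ?E ^ 4 * (dilate 3 ?E * dilate 3 ?E))"
      unfolding dilate_power[OF zero_less_numeral]
    proof (intro ring_cong_mult ring_cong_refl)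
      show "ring_cong 3 (A ^ 3) (dilate 3 ?E)"
        using ring_cong_power[OF \<open>ring_cong 3 A ?E\<close>, of 3] euler_cube_mod_3 by (rule ring_cong_trans)
    qed (rule euler_cube_mod_3)
    also have "dilate 3 ?E ^ 4 * (dilate 3 ?E * dilate 3 ?E) = B\<^sup>2"
      unfolding B_def dilate_power[OF zero_less_numeral] by (simp add: algebra_simps eval_nat_numeral)
    finally have "3 dvd dilate 3 (?E ^ 4) * (A ^ 3 * ?E ^ 3) - B\<^sup>2" by (simp add: ring_cong_def)
    hence "9 * 3 dvd 9 * (dilate 3 (?E ^ 4) * (A ^ 3 * ?E ^ 3) - B\<^sup>2)" by (rule mult_dvd_mono[OF dvd_refl])
    thus ?thesis by (simp add: ring_cong_def algebra_simps)
  qed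
  from ring_cong_trans[OF main ring_cong_sym[OF this]]
  have "ring_cong 27 ((A ^ 3 * ?E ^ 3) * fps_section 3 2 C) ((A ^ 3 * ?E ^ 3) * (9 * dilate 3 (?E ^ 4)))"
    by (subst (1 2) mult.commute)
  moreover have "A ^ 3 * ?E ^ 3 dvd 1"
    by (rule is_unit_fps) (simp add: A_def fps_nth_power_0)
  ultimately show ?thesis by (rule ring_cong_cancel_unit)
qed

text \<open>
  The right-hand side of \<open>section_2_mod_27\<close> is a series in \<open>q^3\<close>, so a second section recovers \<open>E^4\<close>.
  It is traded for \<open>E(q) E(q^3)\<close>, a product of two sparse series.
\<close>

lemma nine_k_plus_2_mod_27:
  assumes C: "C * euler_fps ^ 3 * dilate 3 euler_fps ^ 3 = 1"
  shows "[fps_nth C (9 * k + 2) = 9 * fps_nth (euler_fps * dilate 3 euler_fps) k] (mod 27)"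
proof -
  let ?E = euler_fps
  have "27 dvd fps_nth (fps_section 3 2 C) (3 * k) - 9 * fps_nth (?E ^ 4) k"
    using section_2_mod_27[OF C] unfolding ring_cong_numeral_nth
    by (auto dest!: spec[of _ "3 * k"] simp: dilate_nth fps_mult_numeral_left)
  moreover have "ring_cong 3 (?E * ?E ^ 3) (?E * dilate 3 ?E)"
    by (intro ring_cong_mult ring_cong_refl euler_cube_mod_3)
  hence "3 dvd fps_nth (?E ^ 4) k - fps_nth (?E * dilate 3 ?E) k"
    unfolding ring_cong_numeral_nth by (simp add: eval_nat_numeral)
  hence "27 dvd 9 * fps_nth (?E ^ 4) k - 9 * fps_nth (?E * dilate 3 ?E) k"
    by presburger
  ultimately have "27 dvd fps_nth (fps_section 3 2 C) (3 * k) - 9 * fps_nth (?E * dilate 3 ?E) k"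
    by presburger
  thus ?thesis by (simp add: cong_iff_dvd_diff)
qed

section \<open>The binary form \<open>x^2 + 3 y^2\<close> at inert primes\<close>

text \<open>
  If \<open>p\<close> did not divide \<open>y\<close>, then \<open>x / y\<close> would be a square root of \<open>-3\<close> modulo \<open>p\<close>.
\<close>

lemma inert_prime_dvd:
  fixes x y :: int and p :: nat
  assumes "prime p" "Legendre (-3) (int p) = -1" "int p dvd x ^ 2 + 3 * y ^ 2"
  shows "int p dvd x \<and> int p dvd y"
proof -
  have pr: "prime (int p)" using assms(1) by simp
  have nres: "\<not> QuadRes (int p) (-3)"
    using assms(2) unfolding Legendre_def by (auto split: if_splits)
  have y: "int p dvd y"
  proof (rule ccontr)
    assume "\<not> int p dvd y"
    hence "coprime y (int p)" using pr by (metis coprime_commute prime_imp_coprime)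
    then obtain u where u: "[y * u = 1] (mod int p)" using cong_solve_coprime_int by blast
    have "[(x * u) ^ 2 = - 3 * (y * u) ^ 2] (mod int p)"
    proof -
      have "int p dvd (x ^ 2 + 3 * y ^ 2) * u ^ 2" using assms(3) by (rule dvd_mult2)
      also have "(x ^ 2 + 3 * y ^ 2) * u ^ 2 = (x * u) ^ 2 - (- 3 * (y * u) ^ 2)"
        by (simp add: algebra_simps)
      finally show ?thesis by (simp add: cong_iff_dvd_diff)
    qed
    also have "[- 3 * (y * u) ^ 2 = - 3 * 1 ^ 2] (mod int p)"
      by (intro cong_mult cong_pow u cong_refl)
    finally show False using nres unfolding QuadRes_def by auto
  qed
  hence "int p dvd 3 * y ^ 2" by (simp add: power2_eq_square)
  hence "int p dvd x ^ 2" using assms(3) by (metis dvd_add_left_iff)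
  thus ?thesis using y pr by (metis prime_dvd_power)
qed

text \<open>
  Infinite descent: such a \<open>p\<close> divides both \<open>x\<close> and \<open>y\<close>, so the exponent of \<open>p\<close> in the value of the
  form drops by two at each step and never becomes odd.
\<close>

lemma inert_prime_odd_power:
  fixes x y m :: int and p :: nat
  assumes p: "prime p" "Legendre (-3) (int p) = -1" and m: "\<not> int p dvd m"
  shows "x ^ 2 + 3 * y ^ 2 \<noteq> int p ^ (2 * a + 1) * m"
proof (induction a arbitrary: x y)
  case (0 x y)
  show ?case
  proof
    assume eq: "x ^ 2 + 3 * y ^ 2 = int p ^ (2 * 0 + 1) * m"
    hence "int p dvd x \<and> int p dvd y" by (intro inert_prime_dvd[OF p]) simp
    then obtain u v where "x = int p * u" "y = int p * v" by (auto elim!: dvdE)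
    hence "int p * (int p * (u ^ 2 + 3 * v ^ 2)) = int p * m"
      using eq by (simp add: algebra_simps power2_eq_square)
    hence "int p * (u ^ 2 + 3 * v ^ 2) = m" using p(1) by (simp add: prime_gt_0_nat)
    with m show False by auto
  qed
next
  case (Suc a x y)
  show ?case
  proof
    assume eq: "x ^ 2 + 3 * y ^ 2 = int p ^ (2 * Suc a + 1) * m"
    hence "int p dvd x \<and> int p dvd y" by (intro inert_prime_dvd[OF p]) simp
    then obtain u v where "x = int p * u" "y = int p * v" by (auto elim!: dvdE)
    hence "(int p * int p) * (u ^ 2 + 3 * v ^ 2) = (int p * int p) * (int p ^ (2 * a + 1) * m)"
      using eq by (simp add: algebra_simps power2_eq_square)
    hence "u ^ 2 + 3 * v ^ 2 = int p ^ (2 * a + 1) * m" using p(1) by (simp add: prime_gt_0_nat)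
    with Suc show False by blast
  qed
qed

text \<open>
  A nonzero term of the Cauchy product has \<open>k = i + 3j\<close> with \<open>24 i + 1\<close> and \<open>24 j + 1\<close> squares, which
  represents \<open>24 k + 4\<close> by the form.
\<close>

lemma euler_mult_dilate_3_vanishes:
  assumes "\<And>x y :: int. x ^ 2 + 3 * y ^ 2 \<noteq> 4 * (6 * int k + 1)"
  shows "fps_nth (euler_fps * dilate 3 euler_fps) k = 0"
  unfolding fps_mult_nth
proof (intro sum.neutral ballI)
  fix i assume i: "i \<in> {0..k}"
  show "fps_nth euler_fps i * fps_nth (dilate 3 euler_fps) (k - i) = 0"
  proof (rule ccontr)
    assume "\<not> ?thesis"
    then obtain j where j: "k - i = 3 * j" "fps_nth euler_fps i \<noteq> 0" "fps_nth euler_fps j \<noteq> 0"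
      by (auto simp: dilate_nth split: if_splits elim!: dvdE)
    then obtain x y where xy: "24 * int i + 1 = x ^ 2" "24 * int j + 1 = y ^ 2"
      using euler_support by blast
    have "int k = int i + 3 * int j" using i j(1) by auto
    with xy have "x ^ 2 + 3 * y ^ 2 = 4 * (6 * int k + 1)" by simp
    with assms show False by blast
  qed
qed

section \<open>From the analytic definition to formal power series\<close>

definition complex_fps :: "int fps \<Rightarrow> complex fps" where
  "complex_fps f = Abs_fps (\<lambda>n. of_int (fps_nth f n))"

lemma complex_fps_nth [simp]: "fps_nth (complex_fps f) n = of_int (fps_nth f n)"
  by (simp add: complex_fps_def)

lemma complex_fps_mult: "complex_fps (f * g) = complex_fps f * complex_fps g"
  by (intro fps_ext) (simp add: fps_mult_nth)

lemma complex_fps_1 [simp]: "complex_fps 1 = 1"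
  by (intro fps_ext) auto

lemma complex_fps_power: "complex_fps (f ^ n) = complex_fps f ^ n"
  by (induction n) (auto simp: complex_fps_mult)

lemma complex_fps_eq_iff: "complex_fps f = complex_fps g \<longleftrightarrow> f = g"
  by (auto simp: fps_eq_iff)

lemma qfac_has_fps_expansion:
  "(\<lambda>q. \<Prod>k<N. 1 - q * q ^ k) has_fps_expansion complex_fps (qfac N)"
proof (induction N)
  case (Suc N)
  have "complex_fps (1 - fps_X ^ Suc N) = 1 - fps_X ^ Suc N"
    by (intro fps_ext) (simp add: fps_X_power_nth del: power_Suc)
  moreover have "(\<lambda>q::complex. (\<Prod>k<N. 1 - q * q ^ k) * (1 - q ^ Suc N)) has_fps_expansion
      complex_fps (qfac N) * (1 - fps_X ^ Suc N)"
    by (intro fps_expansion_intros Suc)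
  ultimately show ?case by (simp add: qfac_Suc complex_fps_mult)
qed auto

text \<open>
  The partial products converge uniformly near 0, so their Taylor coefficients converge to those of the
  infinite product, and each of these coefficient sequences is eventually constant.
\<close>

lemma qpochhammer_has_fps_expansion:
  "(\<lambda>q. qpochhammer_inf q q) has_fps_expansion complex_fps euler_fps"
proof -
  let ?g = "\<lambda>q. qpochhammer_inf q q"
  have "(deriv ^^ n) ?g 0 / fact n = of_int (fps_nth euler_fps n)" for n
  proof (rule LIMSEQ_unique)
    have "uniform_limit (ball 0 (1/2)) (\<lambda>N q. \<Prod>k<N. 1 - q * q ^ k) ?g sequentially"
      by (rule uniform_limit_on_subset[OF uniform_limit_qpochhammer[of "1/2"]]) auto
    thus "(\<lambda>N. (deriv ^^ n) (\<lambda>q. \<Prod>k<N. 1 - q * q ^ k) 0 / fact n) \<longlonglongrightarrow> (deriv ^^ n) ?g 0 / fact n"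
      by (intro tendsto_divide tendsto_const higher_deriv_complex_uniform_limit)
         (auto intro!: always_eventually holomorphic_intros)
    have "(deriv ^^ n) (\<lambda>q. \<Prod>k<N. 1 - q * q ^ k) 0 / fact n = (of_int (fps_nth euler_fps n) :: complex)"
      if "N \<ge> n" for N
      using fps_nth_fps_expansion[OF qfac_has_fps_expansion, of N n] qfac_nth_stable[OF that]
      by (simp add: euler_fps_def)
    thus "(\<lambda>N. (deriv ^^ n) (\<lambda>q. \<Prod>k<N. 1 - q * q ^ k) 0 / fact n) \<longlonglongrightarrow>
        (of_int (fps_nth euler_fps n) :: complex)"
      by (intro tendsto_eventually eventually_sequentiallyI[of n]) auto
  qed
  hence "complex_fps euler_fps = fps_expansion ?g 0"
    by (intro fps_ext) (simp add: fps_expansion_def)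
  moreover have "?g has_fps_expansion fps_expansion ?g 0"
    by (rule has_fps_expansion_fps_expansion[of "ball 0 1"]) (auto intro: holomorphic_qpochhammer)
  ultimately show ?thesis by simp
qed

lemma p33_fps:
  "Abs_fps (\<lambda>n. int (p33 n)) * euler_fps ^ 3 * dilate 3 euler_fps ^ 3 = 1"
proof -
  let ?C = "Abs_fps (\<lambda>n. int (p33 n))"
  define e where "e q = qpochhammer_inf q q" for q
  define g where "g q = 1 / (e q ^ 3 * e (q ^ 3) ^ 3)" for q
  have in_disc: "eventually (\<lambda>q. q \<in> ball 0 1) (nhds (0::complex))"
    by (intro eventually_nhds_in_open) auto
  have C: "g has_fps_expansion complex_fps ?C"
  proof (rule has_fps_expansionI)
    show "eventually (\<lambda>q. (\<lambda>n. fps_nth (complex_fps ?C) n * q ^ n) sums g q) (nhds 0)"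
      using in_disc by eventually_elim
        (use p33_generating_p33 in \<open>auto simp: p33_generating_def g_def e_def\<close>)
  qed
  have e: "e has_fps_expansion complex_fps euler_fps"
    using qpochhammer_has_fps_expansion by (simp add: e_def[abs_def])
  have "(e \<circ> (\<lambda>q. q ^ 3)) has_fps_expansion fps_compose (complex_fps euler_fps) (fps_X ^ 3)"
    by (intro has_fps_expansion_compose e fps_expansion_intros) auto
  also have "fps_compose (complex_fps euler_fps) (fps_X ^ 3) = complex_fps (dilate 3 euler_fps)"
    by (intro fps_ext) (simp add: dilate_nth fps_nth_compose_X_power)
  finally have e3: "(\<lambda>q. e (q ^ 3)) has_fps_expansion complex_fps (dilate 3 euler_fps)"
    by (simp add: o_def)
  have "(\<lambda>q. g q * e q ^ 3 * e (q ^ 3) ^ 3) has_fps_expansion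
      complex_fps ?C * complex_fps euler_fps ^ 3 * complex_fps (dilate 3 euler_fps) ^ 3"
    by (intro fps_expansion_intros C e e3)
  hence product: "(\<lambda>q. g q * e q ^ 3 * e (q ^ 3) ^ 3) has_fps_expansion
      complex_fps (?C * euler_fps ^ 3 * dilate 3 euler_fps ^ 3)"
    by (simp only: complex_fps_mult complex_fps_power)
  have eq_1: "eventually (\<lambda>q. g q * e q ^ 3 * e (q ^ 3) ^ 3 = 1) (nhds 0)"
    using in_disc
  proof eventually_elim
    case (elim q)
    hence "e q \<noteq> 0" "e (q ^ 3) \<noteq> 0"
      unfolding e_def by (auto intro!: qpochhammer_inf_nonzero simp: norm_power power_less_one_iff)
    thus ?case by (simp add: g_def)
  qed
  have "(\<lambda>_. 1) has_fps_expansion complex_fps (?C * euler_fps ^ 3 * dilate 3 euler_fps ^ 3)"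
    using product unfolding has_fps_expansion_cong[OF eq_1 refl] .
  hence "complex_fps (?C * euler_fps ^ 3 * dilate 3 euler_fps ^ 3) = complex_fps 1"
    using fps_expansion_unique_complex has_fps_expansion_1 by (metis complex_fps_1)
  thus ?thesis unfolding complex_fps_eq_iff .
qed

section \<open>Indices with an odd power of an inert prime\<close>

text \<open>
  Write \<open>M = p^(2\<alpha> - 1)\<close>. As \<open>M p = p^(2\<alpha>)\<close> is the square of an integer prime to 6, it has the form
  \<open>6 t + 1\<close>. Hence the index has the form \<open>9 k + 2\<close>, and \<open>6 k + 1 = M (p (6n + 1) + 6 j)\<close>, where \<open>p\<close> does
  not divide the second factor because it does not divide \<open>6 j\<close>.
\<close>

theorem theorem1p2:
  fixes n \<alpha> p j :: nat
  assumes "\<alpha> \<ge> 1"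
    and "prime p" and "odd p"
    and "Legendre (-3) (int p) = -1"
    and "j \<in> {1..p - 1}"
  shows "[p33 (9 * p ^ (2 * \<alpha>) * n + (p ^ (2 * \<alpha> - 1) * (3 * p + 18 * j) + 1) div 2) = 0] (mod 27)"
proof -
  define M where "M = p ^ (2 * \<alpha> - 1)"
  have pM: "p ^ (2 * \<alpha>) = M * p"
    using assms(1) unfolding M_def by (cases \<alpha>) auto
  have "p \<noteq> 3" using assms(4) by (auto simp: Legendre_def cong_def)
  have prime_3: "prime (3::nat)" by (simp add: prime_nat_numeral_eq)
  have "\<not> 3 dvd p" using \<open>p \<noteq> 3\<close> primes_dvd_imp_eq[OF prime_3 assms(2)] by auto
  have "p mod 6 = 1 \<or> p mod 6 = 5" using \<open>\<not> 3 dvd p\<close> assms(3) by presburger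
  hence "p ^ 2 mod 6 = 1" by (auto simp: power2_eq_square mod_mult_eq[symmetric, of p p])
  hence "[(p ^ 2) ^ \<alpha> = 1 ^ \<alpha>] (mod 6)" by (intro cong_pow) (simp add: cong_def)
  hence "M * p mod 6 = 1" by (simp add: cong_def pM[symmetric] power_mult)
  then obtain t where t: "M * p = 6 * t + 1" by (metis mult_div_mod_eq)
  define k where "k = M * p * n + t + j * M"
  have N: "9 * p ^ (2 * \<alpha>) * n + (p ^ (2 * \<alpha> - 1) * (3 * p + 18 * j) + 1) div 2 = 9 * k + 2"
  proof -
    have "M * (3 * p + 18 * j) + 1 = 2 * (9 * t + 9 * (j * M) + 2)"
      using t by (simp add: algebra_simps)
    hence "(M * (3 * p + 18 * j) + 1) div 2 = 9 * t + 9 * (j * M) + 2" by simp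
    thus ?thesis unfolding M_def[symmetric] pM k_def by (simp add: algebra_simps)
  qed
  have "6 * k + 1 = (6 * t + 1) + 6 * (M * p * n + j * M)"
    by (simp add: k_def)
  also have "\<dots> = M * (p * (6 * n + 1) + 6 * j)"
    unfolding t[symmetric] by (simp add: algebra_simps)
  finally have "4 * (6 * k + 1) = M * (4 * (p * (6 * n + 1) + 6 * j))"
    by (simp only: mult.left_commute)
  moreover have "4 * (6 * int k + 1) = int (4 * (6 * k + 1))" by simp
  ultimately have "4 * (6 * int k + 1) = int (M * (4 * (p * (6 * n + 1) + 6 * j)))" by (simp only:)
  also have "\<dots> = int p ^ (2 * (\<alpha> - 1) + 1) * int (4 * (p * (6 * n + 1) + 6 * j))"
    using assms(1) by (cases \<alpha>) (auto simp: M_def)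
  finally have k: "4 * (6 * int k + 1) = int p ^ (2 * (\<alpha> - 1) + 1) * int (4 * (p * (6 * n + 1) + 6 * j))" .
  have "\<not> p dvd 4 * (p * (6 * n + 1) + 6 * j)"
  proof
    assume "p dvd 4 * (p * (6 * n + 1) + 6 * j)"
    also have "4 * (p * (6 * n + 1) + 6 * j) = p * (4 * (6 * n + 1)) + 2 ^ 3 * 3 * j"
      by (simp add: algebra_simps)
    finally have "p dvd 2 ^ 3 * 3 * j" by (simp only: dvd_add_right_iff[OF dvd_triv_left])
    hence "p dvd 2 \<or> p dvd 3 \<or> p dvd j"
      using assms(2) by (meson prime_dvd_mult_nat prime_dvd_power)
    moreover have "\<not> p dvd j" using assms(5) by (auto dest: dvd_imp_le)
    ultimately show False
      using assms(2,3) \<open>p \<noteq> 3\<close> primes_dvd_imp_eq[OF assms(2) prime_3]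
        primes_dvd_imp_eq[OF assms(2) two_is_prime_nat] by auto
  qed
  hence "\<not> int p dvd int (4 * (p * (6 * n + 1) + 6 * j))" by (simp only: int_dvd_int_iff not_False_eq_True)
  hence "fps_nth (euler_fps * dilate 3 euler_fps) k = 0"
    by (intro euler_mult_dilate_3_vanishes) (simp only: k inert_prime_odd_power[OF assms(2,4)] not_False_eq_True)
  hence "[int (p33 (9 * k + 2)) = int 0] (mod int 27)"
    using nine_k_plus_2_mod_27[OF p33_fps, of k] by simp
  thus ?thesis unfolding N cong_int_iff .
qed

end
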